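(* Let $k\ge 1$ and let $\Upsilon$ be a subset of $\mathcal{F}_{2,k}$. Then $$1+\sum_{n\ge 1}\frac{Alt^{\Upsilon}_{2n}t^{2n}}{(2kn)!}=\frac{1}{1+\sum_{n\ge 1}\frac{(-1)^{n}t^{2n}}{(2kn)!}\,full^{\Upsilon}_{2n}}$$ and $$\sum_{n\ge 1}\frac{Alt^{\Upsilon}_{2n-1}t^{2n-1}}{(k(2n-1))!}=\frac{\sum_{n\ge 1}\frac{(-1)^{n-1}t^{2n-1}}{(k(2n-1))!}\,full^{\Upsilon}_{2n-1}}{1+\sum_{n\ge 1}\frac{(-1)^{n}t^{2n}}{(2kn)!}\,full^{\Upsilon}_{2n}}.$$
   Context: $\mathcal{F}_{n,k}$ is the set of all fillings $F$ of the $k\times n$ rectangular array ($k$ rows, $n$ columns) with the integers $1,\dots,kn$, each used once, such that the elements in each column increase from bottom to top. For a filling of a $k\times n$ array by distinct positive integers with columns increasing from bottom to top, $\mathrm{red}(F)\in\mathcal{F}_{n,k}$ is obtained by replacing the $i$-th smallest entry by $i$. $F[i,i+1]$ is the $k\times 2$ filling formed by columns $i$ and $i+1$ of $F$. For $\Upsilon\subseteq\mathcal{F}_{2,k}$, $F\in\mathcal{F}_{n,k}$ has an $\Upsilon$-match starting at position $i$ ($1\le i\le n-1$) if $\mathrm{red}(F[i,i+1])\in\Upsilon$. $F\in\mathcal{F}_{n,k}$ is $\Upsilon$-alternating if $\mathrm{red}(F[2i+1,2i+2])\in\Upsilon$ for all integers $0\le i\le (n-2)/2$ and $\mathrm{red}(F[2i,2i+1])\notin\Upsilon$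 for all integers $0<i\le (n-1)/2$. $Alt^{\Upsilon}_n$ is the number of $\Upsilon$-alternating elements of $\mathcal{F}_{n,k}$. $full^{\Upsilon}_n$ is the number of $F\in\mathcal{F}_{n,k}$ with $\Upsilon$-matches starting at every position $1,\dots,n-1$, with $full^{\Upsilon}_1=1$ by convention. The identities are of formal power series in $t$ over $\mathbb{Q}$. *)

theory Defs
  imports Complex_Main "HOL-Library.FuncSet" "HOL-Computational_Algebra.Formal_Power_Series"
begin

text \<open>
  A cell is a pair (row, column); rows are numbered from bottom to top and columns from left to
  right, both starting at 1. An array is a function on cells, made unique by being
  \<^term>\<open>undefined\<close> outside of its \<open>k \<times> n\<close> rectangle, so that arrays can be counted and compared.
\<close>

type_synonym arr = "nat \<times> nat \<Rightarrow> nat"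

definition cells :: "nat \<Rightarrow> nat \<Rightarrow> (nat \<times> nat) set" where
  "cells n k = {1..k} \<times> {1..n}"

definition fillings :: "nat \<Rightarrow> nat \<Rightarrow> arr set" where
  "fillings n k = {F \<in> extensional (cells n k).
     bij_betw F (cells n k) {1..k * n} \<and>
     (\<forall>j\<in>{1..n}. strict_mono_on {1..k} (\<lambda>i. F (i, j)))}"

definition red :: "nat \<Rightarrow> nat \<Rightarrow> arr \<Rightarrow> arr" where
  "red n k F = (\<lambda>c\<in>cells n k. card {x \<in> F ` cells n k. x \<le> F c})"

definition column_pair :: "nat \<Rightarrow> arr \<Rightarrow> nat \<Rightarrow> arr" where
  "column_pair k F i = (\<lambda>(r, c)\<in>cells 2 k. if c = 1 then F (r, i) else F (r, i + 1))"

definition match_at :: "nat \<Rightarrow> arr set \<Rightarrow> arr \<Rightarrow> nat \<Rightarrow> bool" where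
  "match_at k \<Upsilon> F i \<longleftrightarrow> red 2 k (column_pair k F i) \<in> \<Upsilon>"

text \<open>
  The bounds \<open>i \<le> (n - 2) / 2\<close> and \<open>i \<le> (n - 1) / 2\<close> are written without subtraction and division,
  which would truncate on the natural numbers.
\<close>

definition alternating :: "nat \<Rightarrow> nat \<Rightarrow> arr set \<Rightarrow> arr \<Rightarrow> bool" where
  "alternating n k \<Upsilon> F \<longleftrightarrow>
     (\<forall>i. 2 * i + 2 \<le> n \<longrightarrow> match_at k \<Upsilon> F (2 * i + 1)) \<and>
     (\<forall>i. 0 < i \<and> 2 * i + 1 \<le> n \<longrightarrow> \<not> match_at k \<Upsilon> F (2 * i))"

definition Alt :: "nat \<Rightarrow> arr set \<Rightarrow> nat \<Rightarrow> nat" where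
  "Alt k \<Upsilon> n = card {F \<in> fillings n k. alternating n k \<Upsilon> F}"

definition full :: "nat \<Rightarrow> arr set \<Rightarrow> nat \<Rightarrow> nat" where
  "full k \<Upsilon> n = (if n = 1 then 1
     else card {F \<in> fillings n k. \<forall>i\<in>{1..n - 1}. match_at k \<Upsilon> F i})"

text \<open>The formal power series \<open>\<Sum>n\<ge>1. a n * t^(2n)\<close> and \<open>\<Sum>n\<ge>1. a n * t^(2n-1)\<close>.\<close>

definition even_series :: "(nat \<Rightarrow> rat) \<Rightarrow> rat fps" where
  "even_series a = Abs_fps (\<lambda>m. if even m \<and> 0 < m then a (m div 2) else 0)"

definition odd_series :: "(nat \<Rightarrow> rat) \<Rightarrow> rat fps" where
  "odd_series a = Abs_fps (\<lambda>m. if odd m then a ((m + 1) div 2) else 0)"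

end

theory Submission
  imports Defs
begin

text \<open>
  Call the set of positions at which a filling has a match its match set. The fillings counted by
  \<^const>\<open>Alt\<close> are those whose match set is the set of odd positions, and those counted by
  \<^const>\<open>full\<close> are those whose match set contains every position. Whether there is a match
  depends only on the relative order of the entries, so a filling with \<open>a + b\<close> columns is built by
  choosing which \<open>k * a\<close> entries go to the first \<open>a\<close> columns and choosing the two parts
  independently. As the two parts determine the match set except at position \<open>a\<close>, the numbers
  \<open>\<beta> n I\<close> of fillings with \<open>n\<close> columns and match set \<open>I\<close> obey the product rule
  (\<open>match_count_mult\<close>) of ribbon Schur functions,
  \<open>((k * (a + b)) choose (k * a)) * \<beta> a I * \<beta> b J = \<beta> (a + b) K + \<beta> (a + b) (insert a K)\<close>,
  where \<open>K = I \<union> (a + J)\<close> and \<open>a, b \<ge> 1\<close>.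

  Let \<open>D j\<close> be the number of fillings with \<open>n\<close> columns whose matches are exactly the odd
  positions together with the even positions up to \<open>2 * j\<close>. Placing a filling with \<open>2 * j\<close> columns
  and all matches to the left of an alternating filling gives, by the product rule, for
  \<open>0 < 2 * j < n\<close>,
  \<open>((k * n) choose (2 * k * j)) * full (2 * j) * Alt (n - 2 * j) = D (j - 1) + D j\<close>.
  The full part has an even number of columns, so odd positions of the right part stay odd. Hence
  the alternating sum of the left-hand sides over all \<open>j\<close> with \<open>2 * j \<le> n\<close> telescopes. The left-hand
  side is \<open>D 0\<close> for \<open>j = 0\<close>, and \<open>full n = D (j - 1)\<close> for \<open>2 * j = n > 0\<close>. So everything cancels
  for even \<open>n > 0\<close>, while for odd \<open>n\<close> the term \<open>D (n div 2) = full n\<close> remains, up to sign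
  (\<open>alternating_sum_full_Alt_complete\<close>). Divided by \<open>(k * n)!\<close>, these relations say that the
  denominator series times the even series of \<^const>\<open>Alt\<close> is \<open>1\<close>, and that the denominator
  series times the odd series of \<^const>\<open>Alt\<close> is the numerator series.
\<close>

section \<open>Fillings by an arbitrary set of entries and their match sets\<close>

text \<open>
  Column-increasing arrays whose entries are the elements of \<open>S\<close>, each used once. The parts of a
  filling are of this kind.
\<close>

definition fillings_on :: "nat set \<Rightarrow> nat \<Rightarrow> nat \<Rightarrow> arr set" where
  "fillings_on S n k = {F \<in> extensional (cells n k).
     bij_betw F (cells n k) S \<and>
     (\<forall>j\<in>{1..n}. strict_mono_on {1..k} (\<lambda>i. F (i, j)))}"

text \<open>The set of positions at which \<open>F\<close> has a match.\<close>

definition match_set :: "nat \<Rightarrow> nat \<Rightarrow> arr set \<Rightarrow> arr \<Rightarrow> nat set" where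
  "match_set n k \<Upsilon> F = {i \<in> {1..<n}. match_at k \<Upsilon> F i}"

text \<open>The number of fillings with \<open>n\<close> columns and match set exactly \<open>I\<close>.\<close>

definition match_count :: "nat \<Rightarrow> arr set \<Rightarrow> nat \<Rightarrow> nat set \<Rightarrow> nat" where
  "match_count k \<Upsilon> n I = card {F \<in> fillings n k. match_set n k \<Upsilon> F = I}"

lemma fillings_eq_fillings_on: "fillings n k = fillings_on {1..k * n} n k"
  by (simp add: fillings_def fillings_on_def)

lemma finite_cells [simp]: "finite (cells n k)"
  by (simp add: cells_def)

lemma card_cells [simp]: "card (cells n k) = k * n"
  by (simp add: cells_def)

lemma finite_fillings_on: "finite S \<Longrightarrow> finite (fillings_on S n k)"
proof (rule finite_subset)
  show "fillings_on S n k \<subseteq> cells n k \<rightarrow>\<^sub>E S"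
    by (auto simp: fillings_on_def PiE_def bij_betw_def)
qed (auto intro: finite_PiE)

lemma finite_fillings [simp]: "finite (fillings n k)"
  by (simp add: fillings_eq_fillings_on finite_fillings_on)

lemma red_compose:
  assumes "strict_mono_on (F ` cells n k) h" and "\<And>c. c \<in> cells n k \<Longrightarrow> G c = h (F c)"
  shows "red n k G = red n k F"
proof
  fix c
  show "red n k G c = red n k F c"
  proof (cases "c \<in> cells n k")
    case True
    have "{x \<in> G ` cells n k. x \<le> G c} = h ` {x \<in> F ` cells n k. x \<le> F c}"
      using assms True by (auto simp: strict_mono_on_less_eq)
    moreover have "inj_on h {x \<in> F ` cells n k. x \<le> F c}"
      using strict_mono_on_imp_inj_on[OF assms(1)] by (rule inj_on_subset) auto
    ultimately show ?thesis
      using True by (simp add: red_def card_image)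
  qed (simp add: red_def)
qed

lemma match_at_compose:
  assumes "strict_mono_on (F ` cells n k) h" "i \<in> {1..<n}"
  shows "match_at k \<Upsilon> (\<lambda>c\<in>cells n k. h (F c)) i \<longleftrightarrow> match_at k \<Upsilon> F i"
proof -
  have "red 2 k (column_pair k (\<lambda>c\<in>cells n k. h (F c)) i) = red 2 k (column_pair k F i)"
  proof (rule red_compose[where h = h])
    show "strict_mono_on (column_pair k F i ` cells 2 k) h"
      using assms by (intro monotone_on_subset[OF assms(1)]) (auto simp: column_pair_def cells_def)
  qed (use assms in \<open>auto simp: column_pair_def cells_def\<close>)
  thus ?thesis
    by (simp add: match_at_def)
qed

lemma match_set_compose:
  assumes "strict_mono_on (F ` cells n k) h"
  shows "match_set n k \<Upsilon> (\<lambda>c\<in>cells n k. h (F c)) = match_set n k \<Upsilon> F"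
  using match_at_compose[OF assms] by (auto simp: match_set_def)

lemma compose_in_fillings_on:
  assumes "F \<in> fillings_on S n k" "strict_mono_on S h" "bij_betw h S T"
  shows "(\<lambda>c\<in>cells n k. h (F c)) \<in> fillings_on T n k"
proof -
  have F: "bij_betw F (cells n k) S" "\<And>j. j \<in> {1..n} \<Longrightarrow> strict_mono_on {1..k} (\<lambda>i. F (i, j))"
    using assms(1) by (auto simp: fillings_on_def)
  have inS: "F c \<in> S" if "c \<in> cells n k" for c
    using F(1) that by (auto simp: bij_betw_def)
  have "bij_betw (h \<circ> F) (cells n k) T"
    using F(1) assms(3) by (rule bij_betw_trans)
  hence "bij_betw (\<lambda>c\<in>cells n k. h (F c)) (cells n k) T"
    by (rule bij_betw_cong[THEN iffD1, rotated]) simp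
  moreover have "strict_mono_on {1..k} (\<lambda>i. (\<lambda>c\<in>cells n k. h (F c)) (i, j))"
    if j: "j \<in> {1..n}" for j
  proof (rule strict_mono_onI)
    fix r s assume rs: "r \<in> {1..k}" "s \<in> {1..k}" "r < s"
    hence "(r, j) \<in> cells n k" "(s, j) \<in> cells n k" "F (r, j) < F (s, j)"
      using j F(2)[OF j] by (auto simp: cells_def strict_mono_on_def)
    thus "(\<lambda>c\<in>cells n k. h (F c)) (r, j) < (\<lambda>c\<in>cells n k. h (F c)) (s, j)"
      using inS assms(2) by (auto simp: strict_mono_on_def)
  qed
  ultimately show ?thesis
    by (auto simp: fillings_on_def)
qed

lemma ex_strict_mono_enumeration:
  fixes S :: "nat set"
  assumes "finite S"
  obtains h where "strict_mono_on S h" "bij_betw h S {1..card S}"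
proof -
  define h where "h x = card {y \<in> S. y \<le> x}" for x
  have mono: "strict_mono_on S h"
  proof (rule strict_mono_onI)
    fix x y assume "x \<in> S" "y \<in> S" "x < y"
    hence "y \<notin> {z \<in> S. z \<le> x}" "y \<in> {z \<in> S. z \<le> y}" "{z \<in> S. z \<le> x} \<subseteq> {z \<in> S. z \<le> y}"
      by auto
    hence "{z \<in> S. z \<le> x} \<subset> {z \<in> S. z \<le> y}"
      by blast
    thus "h x < h y"
      unfolding h_def using assms by (intro psubset_card_mono) auto
  qed
  have "h ` S \<subseteq> {1..card S}"
    using assms by (auto simp: h_def Suc_le_eq card_gt_0_iff intro: card_mono)
  moreover have "card (h ` S) = card S"
    using mono by (intro card_image strict_mono_on_imp_inj_on)
  ultimately have "h ` S = {1..card S}"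
    by (intro card_subset_eq) auto
  thus ?thesis
    using mono that strict_mono_on_imp_inj_on[OF mono] by (auto simp: bij_betw_def)
qed

lemma strict_mono_on_inv_into:
  fixes h :: "nat \<Rightarrow> nat"
  assumes "strict_mono_on S h"
  shows "strict_mono_on (h ` S) (inv_into S h)"
proof (rule strict_mono_onI)
  fix x y assume "x \<in> h ` S" "y \<in> h ` S" "x < y"
  thus "inv_into S h x < inv_into S h y"
    using assms strict_mono_on_imp_inj_on[OF assms] by (auto simp: strict_mono_on_less)
qed

text \<open>
  The set of entries does not matter: relabelling along the increasing bijection onto
  \<open>{1..k * n}\<close> preserves match sets.
\<close>

lemma card_fillings_on_match_set:
  assumes "finite S" "card S = k * n"
  shows "card {F \<in> fillings_on S n k. match_set n k \<Upsilon> F = I} = match_count k \<Upsilon> n I"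
proof -
  obtain h where h: "strict_mono_on S h" "bij_betw h S {1..k * n}"
    using ex_strict_mono_enumeration[OF assms(1)] assms(2) by metis
  let ?g = "inv_into S h"
  have im: "h ` S = {1..k * n}" and inj: "inj_on h S"
    using h(2) by (auto simp: bij_betw_def)
  have g: "strict_mono_on {1..k * n} ?g" "bij_betw ?g {1..k * n} S"
    using strict_mono_on_inv_into[OF h(1)] im h(2) by (auto intro: bij_betw_inv_into)
  have image: "F ` cells n k = T" if "F \<in> fillings_on T n k" for F T
    using that by (auto simp: fillings_on_def bij_betw_def)
  have ext: "(\<lambda>c\<in>cells n k. F c) = F" if "F \<in> fillings_on T n k" for F T
    using that by (auto simp: fillings_on_def extensional_restrict)
  have "bij_betw (\<lambda>F. \<lambda>c\<in>cells n k. h (F c))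
      {F \<in> fillings_on S n k. match_set n k \<Upsilon> F = I}
      {F \<in> fillings_on {1..k * n} n k. match_set n k \<Upsilon> F = I}"
  proof (rule bij_betw_byWitness[where f' = "\<lambda>F. \<lambda>c\<in>cells n k. ?g (F c)"])
    show "\<forall>F\<in>{F \<in> fillings_on S n k. match_set n k \<Upsilon> F = I}.
        (\<lambda>c\<in>cells n k. ?g ((\<lambda>c\<in>cells n k. h (F c)) c)) = F"
    proof
      fix F assume "F \<in> {F \<in> fillings_on S n k. match_set n k \<Upsilon> F = I}"
      hence F: "F \<in> fillings_on S n k" by simp
      have "(\<lambda>c\<in>cells n k. ?g ((\<lambda>c\<in>cells n k. h (F c)) c)) = (\<lambda>c\<in>cells n k. F c)"
        using image[OF F] inj by (intro restrict_ext) auto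
      thus "(\<lambda>c\<in>cells n k. ?g ((\<lambda>c\<in>cells n k. h (F c)) c)) = F"
        using ext[OF F] by simp
    qed
    show "\<forall>F\<in>{F \<in> fillings_on {1..k * n} n k. match_set n k \<Upsilon> F = I}.
        (\<lambda>c\<in>cells n k. h ((\<lambda>c\<in>cells n k. ?g (F c)) c)) = F"
    proof
      fix F assume "F \<in> {F \<in> fillings_on {1..k * n} n k. match_set n k \<Upsilon> F = I}"
      hence F: "F \<in> fillings_on {1..k * n} n k" by simp
      have "(\<lambda>c\<in>cells n k. h ((\<lambda>c\<in>cells n k. ?g (F c)) c)) = (\<lambda>c\<in>cells n k. F c)"
      proof (rule restrict_ext)
        fix c assume c: "c \<in> cells n k"
        hence "F c \<in> h ` S" using image[OF F] im by blast
        thus "h ((\<lambda>c\<in>cells n k. ?g (F c)) c) = F c"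
          using c by (simp add: f_inv_into_f)
      qed
      thus "(\<lambda>c\<in>cells n k. h ((\<lambda>c\<in>cells n k. ?g (F c)) c)) = F"
        using ext[OF F] by simp
    qed
    show "(\<lambda>F. \<lambda>c\<in>cells n k. h (F c)) ` {F \<in> fillings_on S n k. match_set n k \<Upsilon> F = I}
        \<subseteq> {F \<in> fillings_on {1..k * n} n k. match_set n k \<Upsilon> F = I}"
      using h by (auto intro: compose_in_fillings_on simp: match_set_compose image)
    show "(\<lambda>F. \<lambda>c\<in>cells n k. ?g (F c)) ` {F \<in> fillings_on {1..k * n} n k. match_set n k \<Upsilon> F = I}
        \<subseteq> {F \<in> fillings_on S n k. match_set n k \<Upsilon> F = I}"
      using g by (auto intro: compose_in_fillings_on simp: match_set_compose image)
  qed
  thus ?thesis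
    by (simp add: match_count_def fillings_eq_fillings_on bij_betw_same_card)
qed

section \<open>Cutting a filling between two columns\<close>

text \<open>The first \<open>a\<close> columns of \<open>F\<close>.\<close>

definition left_part :: "nat \<Rightarrow> nat \<Rightarrow> arr \<Rightarrow> arr" where
  "left_part a k F = restrict F (cells a k)"

text \<open>The \<open>b\<close> columns of \<open>F\<close> that follow the first \<open>a\<close>, renumbered from \<open>1\<close>.\<close>

definition right_part :: "nat \<Rightarrow> nat \<Rightarrow> nat \<Rightarrow> arr \<Rightarrow> arr" where
  "right_part a b k F = (\<lambda>(r, c)\<in>cells b k. F (r, a + c))"

text \<open>The array with the \<open>a\<close> columns of \<open>G\<close> followed by the \<open>b\<close> columns of \<open>H\<close>.\<close>

definition juxtapose :: "nat \<Rightarrow> nat \<Rightarrow> nat \<Rightarrow> arr \<Rightarrow> arr \<Rightarrow> arr" where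
  "juxtapose a b k G H =
     (\<lambda>(r, c)\<in>cells (a + b) k. if c \<le> a then G (r, c) else H (r, c - a))"

lemma match_at_left_part:
  "i \<in> {1..<a} \<Longrightarrow> match_at k \<Upsilon> (left_part a k F) i \<longleftrightarrow> match_at k \<Upsilon> F i"
proof -
  assume "i \<in> {1..<a}"
  hence "column_pair k (left_part a k F) i = column_pair k F i"
    by (auto simp: column_pair_def left_part_def cells_def fun_eq_iff)
  thus ?thesis by (simp add: match_at_def)
qed

lemma match_at_right_part:
  "i \<in> {1..<b} \<Longrightarrow> match_at k \<Upsilon> (right_part a b k F) i \<longleftrightarrow> match_at k \<Upsilon> F (a + i)"
proof -
  assume "i \<in> {1..<b}"
  hence "column_pair k (right_part a b k F) i = column_pair k F (a + i)"
    by (auto simp: column_pair_def right_part_def cells_def fun_eq_iff)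
  thus ?thesis by (simp add: match_at_def)
qed

lemma cells_add: "cells (a + b) k = cells a k \<union> (\<lambda>(r, c). (r, a + c)) ` cells b k"
proof -
  have "(r, c) \<in> (\<lambda>(r, c). (r, a + c)) ` cells b k"
    if "(r, c) \<in> cells (a + b) k" "(r, c) \<notin> cells a k" for r c
    using that by (intro image_eqI[of _ _ "(r, c - a)"]) (auto simp: cells_def)
  moreover have "cells a k \<subseteq> cells (a + b) k" 
    "(\<lambda>(r, c). (r, a + c)) ` cells b k \<subseteq> cells (a + b) k"
    by (auto simp: cells_def)
  ultimately show ?thesis by auto
qed

lemma cells_disjoint: "cells a k \<inter> (\<lambda>(r, c). (r, a + c)) ` cells b k = {}"
  by (auto simp: cells_def)

lemma left_part_in_fillings_on:
  assumes "F \<in> fillings_on U (a + b) k"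
  shows "left_part a k F \<in> fillings_on (F ` cells a k) a k"
proof -
  have "inj_on F (cells (a + b) k)"
    using assms by (auto simp: fillings_on_def bij_betw_def)
  hence "inj_on F (cells a k)"
    by (rule inj_on_subset) (auto simp: cells_def)
  hence "bij_betw (left_part a k F) (cells a k) (F ` cells a k)"
    by (auto simp: left_part_def bij_betw_def inj_on_def)
  moreover have "strict_mono_on {1..k} (\<lambda>i. left_part a k F (i, j))" if "j \<in> {1..a}" for j
  proof -
    have "strict_mono_on {1..k} (\<lambda>i. F (i, j))"
      using assms that by (auto simp: fillings_on_def)
    thus ?thesis
      using that by (auto simp: strict_mono_on_def left_part_def cells_def)
  qed
  ultimately show ?thesis
    by (auto simp: fillings_on_def left_part_def)
qed

lemma right_part_in_fillings_on:
  assumes "F \<in> fillings_on U (a + b) k"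
  shows "right_part a b k F \<in> fillings_on (U - F ` cells a k) b k"
proof -
  let ?s = "\<lambda>(r, c). (r, a + c)"
  have F: "inj_on F (cells (a + b) k)" "F ` cells (a + b) k = U"
    using assms by (auto simp: fillings_on_def bij_betw_def)
  have "U - F ` cells a k = F ` (cells (a + b) k - cells a k)"
    using F by (subst inj_on_image_set_diff[OF F(1)]) (auto simp: cells_def)
  also have "cells (a + b) k - cells a k = ?s ` cells b k"
    using cells_disjoint[of a k b] by (auto simp: cells_add)
  finally have img: "U - F ` cells a k = (F \<circ> ?s) ` cells b k"
    by (simp add: image_comp)
  have "inj_on (F \<circ> ?s) (cells b k)"
  proof (rule comp_inj_on)
    show "inj_on F (?s ` cells b k)"
      using F(1) by (rule inj_on_subset) (simp add: cells_add)
  qed (auto simp: inj_on_def)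
  hence "bij_betw (F \<circ> ?s) (cells b k) (U - F ` cells a k)"
    using img by (simp add: bij_betw_def)
  hence "bij_betw (right_part a b k F) (cells b k) (U - F ` cells a k)"
    by (rule bij_betw_cong[THEN iffD1, rotated]) (auto simp: right_part_def)
  moreover have "strict_mono_on {1..k} (\<lambda>i. right_part a b k F (i, j))" if "j \<in> {1..b}" for j
  proof -
    have "strict_mono_on {1..k} (\<lambda>i. F (i, a + j))"
      using assms that by (auto simp: fillings_on_def)
    thus ?thesis
      using that by (auto simp: strict_mono_on_def right_part_def cells_def)
  qed
  ultimately show ?thesis
    by (auto simp: fillings_on_def right_part_def)
qed

lemma juxtapose_in_fillings_on:
  assumes G: "G \<in> fillings_on S a k" and H: "H \<in> fillings_on T b k" and "S \<inter> T = {}"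
  shows "juxtapose a b k G H \<in> fillings_on (S \<union> T) (a + b) k"
proof -
  let ?s = "\<lambda>(r, c). (r, a + c)" and ?F = "juxtapose a b k G H"
  have "bij_betw G (cells a k) S" "bij_betw H (cells b k) T"
    using G H by (auto simp: fillings_on_def)
  have l: "bij_betw ?F (cells a k) S"
    using \<open>bij_betw G (cells a k) S\<close>
    by (rule bij_betw_cong[THEN iffD1, rotated]) (auto simp: juxtapose_def cells_def)
  have "bij_betw (?F \<circ> ?s) (cells b k) T"
    using \<open>bij_betw H (cells b k) T\<close>
    by (rule bij_betw_cong[THEN iffD1, rotated]) (auto simp: juxtapose_def cells_def)
  moreover have "bij_betw ?s (cells b k) (?s ` cells b k)"
    by (auto simp: bij_betw_def inj_on_def)
  ultimately have "bij_betw ?F (?s ` cells b k) T"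
    using bij_betw_comp_iff by blast
  hence "bij_betw ?F (cells (a + b) k) (S \<union> T)"
    using l assms(3) unfolding cells_add by (intro bij_betw_combine)
  moreover have "strict_mono_on {1..k} (\<lambda>i. ?F (i, j))" if "j \<in> {1..a + b}" for j
  proof (cases "j \<le> a")
    case True
    hence "strict_mono_on {1..k} (\<lambda>i. G (i, j))"
      using G that by (auto simp: fillings_on_def)
    thus ?thesis
      using True that by (auto simp: strict_mono_on_def juxtapose_def cells_def)
  next
    case False
    hence "j - a \<in> {1..b}"
      using that by auto
    hence "strict_mono_on {1..k} (\<lambda>i. H (i, j - a))"
      using H unfolding fillings_on_def by blast
    thus ?thesis
      using False that by (auto simp: strict_mono_on_def juxtapose_def cells_def)
  qed
  ultimately show ?thesis
    by (auto simp: fillings_on_def juxtapose_def)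
qed

lemma left_part_juxtapose:
  "G \<in> fillings_on S a k \<Longrightarrow> left_part a k (juxtapose a b k G H) = G"
  by (auto simp: fillings_on_def left_part_def juxtapose_def cells_def fun_eq_iff extensional_def)

lemma right_part_juxtapose:
  "H \<in> fillings_on T b k \<Longrightarrow> right_part a b k (juxtapose a b k G H) = H"
  by (auto simp: fillings_on_def right_part_def juxtapose_def cells_def fun_eq_iff extensional_def)

lemma juxtapose_parts:
  "F \<in> fillings_on U (a + b) k \<Longrightarrow> juxtapose a b k (left_part a k F) (right_part a b k F) = F"
  by (auto simp: fillings_on_def left_part_def right_part_def juxtapose_def cells_def
        fun_eq_iff extensional_def)

text \<open>
  A filling corresponds to the triple of the entry set \<open>S\<close> of its first \<open>a\<close> columns and its two
  parts. The binomial coefficient counts the choices of \<open>S\<close>.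
\<close>

lemma card_split_fillings:
  fixes a b k :: nat and \<Upsilon> :: "arr set" and I J :: "nat set"
  shows "card {F \<in> fillings (a + b) k. match_set a k \<Upsilon> (left_part a k F) = I \<and>
                match_set b k \<Upsilon> (right_part a b k F) = J} =
         ((k * (a + b)) choose (k * a)) * match_count k \<Upsilon> a I * match_count k \<Upsilon> b J"
    (is "card ?X = _")
proof -
  define U where "U = {1..k * (a + b)}"
  define \<S> where "\<S> = {S. S \<subseteq> U \<and> card S = k * a}"
  define GG where "GG S = {G \<in> fillings_on S a k. match_set a k \<Upsilon> G = I}" for S
  define HH where "HH S = {H \<in> fillings_on S b k. match_set b k \<Upsilon> H = J}" for S
  have X: "?X = {F \<in> fillings_on U (a + b) k. match_set a k \<Upsilon> (left_part a k F) = I \<and>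
                match_set b k \<Upsilon> (right_part a b k F) = J}"
    by (simp add: fillings_eq_fillings_on U_def)
  have fin: "finite S" "finite (U - S)" if "S \<in> \<S>" for S
    using that finite_subset[of S U] by (auto simp: \<S>_def U_def)
  have "bij_betw (\<lambda>F. (F ` cells a k, left_part a k F, right_part a b k F))
          ?X (SIGMA S:\<S>. GG S \<times> HH (U - S))"
    unfolding X
  proof (rule bij_betw_byWitness[where f' = "\<lambda>(S, G, H). juxtapose a b k G H"])
    show "\<forall>F\<in>{F \<in> fillings_on U (a + b) k. match_set a k \<Upsilon> (left_part a k F) = I \<and>
                match_set b k \<Upsilon> (right_part a b k F) = J}.
        (case (F ` cells a k, left_part a k F, right_part a b k F) of
           (S, G, H) \<Rightarrow> juxtapose a b k G H) = F"
      by (auto intro: juxtapose_parts)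
    show "\<forall>p\<in>(SIGMA S:\<S>. GG S \<times> HH (U - S)).
        (\<lambda>F. (F ` cells a k, left_part a k F, right_part a b k F))
          (case p of (S, G, H) \<Rightarrow> juxtapose a b k G H) = p"
    proof
      fix p assume "p \<in> (SIGMA S:\<S>. GG S \<times> HH (U - S))"
      then obtain S G H where p: "p = (S, G, H)" "G \<in> GG S" "H \<in> HH (U - S)"
        by auto
      hence GH: "G \<in> fillings_on S a k" "H \<in> fillings_on (U - S) b k"
        by (auto simp: GG_def HH_def)
      have "juxtapose a b k G H ` cells a k = G ` cells a k"
        by (rule image_cong) (auto simp: juxtapose_def cells_def)
      also have "\<dots> = S"
        using GH(1) by (auto simp: fillings_on_def bij_betw_def)
      finally show "(\<lambda>F. (F ` cells a k, left_part a k F, right_part a b k F))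
          (case p of (S, G, H) \<Rightarrow> juxtapose a b k G H) = p"
        using GH p by (simp add: left_part_juxtapose right_part_juxtapose)
    qed
    show "(\<lambda>F. (F ` cells a k, left_part a k F, right_part a b k F)) `
        {F \<in> fillings_on U (a + b) k. match_set a k \<Upsilon> (left_part a k F) = I \<and>
                match_set b k \<Upsilon> (right_part a b k F) = J} \<subseteq> (SIGMA S:\<S>. GG S \<times> HH (U - S))"
    proof (rule image_subsetI)
      fix F assume F': "F \<in> {F \<in> fillings_on U (a + b) k. match_set a k \<Upsilon> (left_part a k F) = I \<and>
                match_set b k \<Upsilon> (right_part a b k F) = J}"
      hence F: "F \<in> fillings_on U (a + b) k" by simp
      hence inj: "inj_on F (cells (a + b) k)" and im: "F ` cells (a + b) k = U"
        by (auto simp: fillings_on_def bij_betw_def)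
      have sub: "cells a k \<subseteq> cells (a + b) k"
        by (simp add: cells_add)
      have "F ` cells a k \<in> \<S>"
        using sub im card_image[OF inj_on_subset[OF inj sub]] by (auto simp: \<S>_def)
      thus "(F ` cells a k, left_part a k F, right_part a b k F) \<in> (SIGMA S:\<S>. GG S \<times> HH (U - S))"
        using F' left_part_in_fillings_on[OF F] right_part_in_fillings_on[OF F]
        by (auto simp: GG_def HH_def)
    qed
    show "(\<lambda>(S, G, H). juxtapose a b k G H) ` (SIGMA S:\<S>. GG S \<times> HH (U - S)) \<subseteq>
        {F \<in> fillings_on U (a + b) k. match_set a k \<Upsilon> (left_part a k F) = I \<and>
                match_set b k \<Upsilon> (right_part a b k F) = J}"
    proof (rule image_subsetI, clarify)
      fix S G H assume S: "S \<in> \<S>" and "G \<in> GG S" "H \<in> HH (U - S)"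
      hence GH: "G \<in> fillings_on S a k" "H \<in> fillings_on (U - S) b k"
          "match_set a k \<Upsilon> G = I" "match_set b k \<Upsilon> H = J"
        by (auto simp: GG_def HH_def)
      have "juxtapose a b k G H \<in> fillings_on (S \<union> (U - S)) (a + b) k"
        using GH by (intro juxtapose_in_fillings_on) auto
      moreover have "S \<union> (U - S) = U"
        using S by (auto simp: \<S>_def)
      ultimately show "juxtapose a b k G H \<in> fillings_on U (a + b) k \<and>
          match_set a k \<Upsilon> (left_part a k (juxtapose a b k G H)) = I \<and>
          match_set b k \<Upsilon> (right_part a b k (juxtapose a b k G H)) = J"
        using GH by (simp add: left_part_juxtapose right_part_juxtapose)
    qed
  qed
  hence "card ?X = card (SIGMA S:\<S>. GG S \<times> HH (U - S))"
    by (rule bij_betw_same_card)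
  also have "\<dots> = (\<Sum>S\<in>\<S>. card (GG S \<times> HH (U - S)))"
    using fin by (intro card_SigmaI)
      (auto simp: \<S>_def GG_def HH_def U_def intro!: finite_cartesian_product finite_fillings_on
        intro: finite_subset)
  also have "\<dots> = (\<Sum>S\<in>\<S>. match_count k \<Upsilon> a I * match_count k \<Upsilon> b J)"
  proof (rule sum.cong)
    fix S assume S: "S \<in> \<S>"
    hence "card (GG S) = match_count k \<Upsilon> a I"
      using fin(1)[OF S] unfolding GG_def by (intro card_fillings_on_match_set) (auto simp: \<S>_def)
    moreover have "card (U - S) = k * b"
      using S fin(1)[OF S] by (auto simp: \<S>_def U_def card_Diff_subset algebra_simps)
    hence "card (HH (U - S)) = match_count k \<Upsilon> b J"
      using fin(2)[OF S] unfolding HH_def by (intro card_fillings_on_match_set)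
    ultimately show "card (GG S \<times> HH (U - S)) = match_count k \<Upsilon> a I * match_count k \<Upsilon> b J"
      by (simp add: card_cartesian_product)
  qed simp
  also have "card \<S> = (k * (a + b)) choose (k * a)"
    unfolding \<S>_def by (subst n_subsets) (auto simp: U_def)
  hence "(\<Sum>S\<in>\<S>. match_count k \<Upsilon> a I * match_count k \<Upsilon> b J) =
         ((k * (a + b)) choose (k * a)) * match_count k \<Upsilon> a I * match_count k \<Upsilon> b J"
    by simp
  finally show ?thesis .
qed

lemma match_set_parts:
  "match_set a k \<Upsilon> (left_part a k F) = match_set (a + b) k \<Upsilon> F \<inter> {1..<a}"
  "match_set b k \<Upsilon> (right_part a b k F) = {i \<in> {1..<b}. a + i \<in> match_set (a + b) k \<Upsilon> F}"
  by (auto simp: match_set_def match_at_left_part match_at_right_part)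

text \<open>
  The two summands correspond to the two possibilities at the junction position \<open>a\<close>, on which
  the parts impose no condition.
\<close>

lemma match_count_mult:
  assumes "a \<ge> 1" "b \<ge> 1" "I \<subseteq> {1..<a}" "J \<subseteq> {1..<b}"
  shows "((k * (a + b)) choose (k * a)) * match_count k \<Upsilon> a I * match_count k \<Upsilon> b J =
    match_count k \<Upsilon> (a + b) (I \<union> (+) a ` J) + match_count k \<Upsilon> (a + b) (insert a (I \<union> (+) a ` J))"
proof -
  let ?K = "I \<union> (+) a ` J"
  have "match_set a k \<Upsilon> (left_part a k F) = I \<and> match_set b k \<Upsilon> (right_part a b k F) = J
      \<longleftrightarrow> match_set (a + b) k \<Upsilon> F = ?K \<or> match_set (a + b) k \<Upsilon> F = insert a ?K"
    (is "?lhs \<longleftrightarrow> ?rhs") for F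
  proof -
    define M where "M = match_set (a + b) k \<Upsilon> F"
    have M: "M \<subseteq> {1..<a + b}" by (auto simp: M_def match_set_def)
    have split: "M = (M \<inter> {1..<a}) \<union> (M \<inter> {a}) \<union> (+) a ` {i \<in> {1..<b}. a + i \<in> M}"
    proof -
      have "x \<in> (+) a ` {i \<in> {1..<b}. a + i \<in> M}" if "x \<in> M" "x > a" for x
        using that M by (intro image_eqI[of _ _ "x - a"]) auto
      thus ?thesis using M by (force simp: not_less_iff_gr_or_eq)
    qed
    have "M \<inter> {1..<a} = I \<and> {i \<in> {1..<b}. a + i \<in> M} = J \<longleftrightarrow> M = ?K \<or> M = insert a ?K"
    proof
      assume "M \<inter> {1..<a} = I \<and> {i \<in> {1..<b}. a + i \<in> M} = J"
      hence "M = I \<union> (M \<inter> {a}) \<union> (+) a ` J" using split by simp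
      moreover have "M \<inter> {a} = {} \<or> M \<inter> {a} = {a}" by auto
      ultimately show "M = ?K \<or> M = insert a ?K" by auto
    next
      assume "M = ?K \<or> M = insert a ?K"
      thus "M \<inter> {1..<a} = I \<and> {i \<in> {1..<b}. a + i \<in> M} = J"
        using assms(3,4) by auto
    qed
    thus ?thesis by (simp add: match_set_parts[where a = a and b = b] M_def)
  qed
  hence "{F \<in> fillings (a + b) k. match_set a k \<Upsilon> (left_part a k F) = I \<and>
            match_set b k \<Upsilon> (right_part a b k F) = J} =
         {F \<in> fillings (a + b) k. match_set (a + b) k \<Upsilon> F = ?K} \<union>
         {F \<in> fillings (a + b) k. match_set (a + b) k \<Upsilon> F = insert a ?K}"
    by auto
  moreover have "a \<notin> ?K" using assms by auto
  hence "{F \<in> fillings (a + b) k. match_set (a + b) k \<Upsilon> F = ?K} \<inter>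
         {F \<in> fillings (a + b) k. match_set (a + b) k \<Upsilon> F = insert a ?K} = {}"
    by auto
  ultimately show ?thesis
    unfolding card_split_fillings[symmetric] by (simp add: match_count_def card_Un_disjoint)
qed

section \<open>The numbers of alternating and of fully matching fillings\<close>

lemma fillings_0: "fillings 0 k = {\<lambda>_. undefined}"
  by (auto simp: fillings_def cells_def bij_betw_def)

lemma fillings_1: "fillings 1 k = {\<lambda>(r, c)\<in>cells 1 k. r}"
proof -
  have "F = (\<lambda>(r, c)\<in>cells 1 k. r)" if F: "F \<in> fillings 1 k" for F
  proof
    fix x :: "nat \<times> nat"
    obtain r c where x: "x = (r, c)" by force
    show "F x = (\<lambda>(r, c)\<in>cells 1 k. r) x"
    proof (cases "x \<in> cells 1 k")
      case True
      have mono: "strict_mono_on {1..k} (\<lambda>i. F (i, 1))" and "bij_betw F (cells 1 k) {1..k}"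
        using F by (auto simp: fillings_def)
      hence im: "(\<lambda>i. F (i, 1)) ` {1..k} = {1..k}"
        by (auto simp: bij_betw_def cells_def image_iff set_eq_iff)
      have r: "r \<in> {1..k}" "c = 1"
        using True x by (auto simp: cells_def)
      hence "F (r, 1) \<in> {1..k}"
        using im by blast
      \<comment> \<open>The entry in row \<open>r\<close> equals its rank \<open>r\<close> among the entries.\<close>
      hence "{1..F (r, 1)} = {y \<in> (\<lambda>i. F (i, 1)) ` {1..k}. y \<le> F (r, 1)}"
        unfolding im by auto
      also have "\<dots> = (\<lambda>i. F (i, 1)) ` {1..r}"
        using r strict_mono_on_less_eq[OF mono] by auto
      finally have "F (r, 1) = card ((\<lambda>i. F (i, 1)) ` {1..r})"
        by (metis card_atLeastAtMost diff_Suc_1)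
      also have "inj_on (\<lambda>i. F (i, 1)) {1..r}"
        using r by (intro inj_on_subset[OF strict_mono_on_imp_inj_on[OF mono]]) auto
      hence "card ((\<lambda>i. F (i, 1)) ` {1..r}) = r"
        by (simp add: card_image)
      finally show ?thesis
        using True x r by simp
    next
      case False
      moreover have "F \<in> extensional (cells 1 k)"
        using F by (simp add: fillings_def)
      ultimately show ?thesis
        using False extensional_arb[of F "cells 1 k" x] by simp
    qed
  qed
  moreover have "(\<lambda>(r, c)\<in>cells 1 k. r) \<in> fillings 1 k"
  proof -
    have "bij_betw (\<lambda>(r, c)\<in>cells 1 k. r) (cells 1 k) {1..k}"
      by (rule bij_betw_byWitness[where f' = "\<lambda>r. (r, 1)"]) (auto simp: cells_def)
    thus ?thesis
      by (auto simp: fillings_def strict_mono_on_def cells_def)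
  qed
  ultimately show ?thesis by blast
qed

lemma match_count_0: "match_count k \<Upsilon> 0 {} = 1"
  by (simp add: match_count_def match_set_def fillings_0)

lemma match_count_1: "match_count k \<Upsilon> (Suc 0) {} = 1"
  using fillings_1[of k] by (simp add: match_count_def match_set_def)

lemma Alt_eq_match_count: "Alt k \<Upsilon> n = match_count k \<Upsilon> n {i \<in> {1..<n}. odd i}"
proof -
  have "alternating n k \<Upsilon> F \<longleftrightarrow> match_set n k \<Upsilon> F = {i \<in> {1..<n}. odd i}" for F
  proof
    assume alt: "alternating n k \<Upsilon> F"
    have "match_at k \<Upsilon> F i \<longleftrightarrow> odd i" if "i \<in> {1..<n}" for i
    proof (cases "odd i")
      case True
      then obtain j where "i = 2 * j + 1" by (elim oddE)
      thus ?thesis using alt that by (auto simp: alternating_def)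
    next
      case False
      then obtain j where "i = 2 * j" by auto
      thus ?thesis using alt that by (auto simp: alternating_def)
    qed
    thus "match_set n k \<Upsilon> F = {i \<in> {1..<n}. odd i}"
      by (auto simp: match_set_def)
  next
    assume eq: "match_set n k \<Upsilon> F = {i \<in> {1..<n}. odd i}"
    have "match_at k \<Upsilon> F i \<longleftrightarrow> odd i" if "i \<in> {1..<n}" for i
      using that eq unfolding match_set_def by blast
    thus "alternating n k \<Upsilon> F"
      by (auto simp: alternating_def)
  qed
  thus ?thesis by (simp add: Alt_def match_count_def)
qed

text \<open>
  There is exactly one filling with a single column, so the value of \<^const>\<open>full\<close> set by convention
  at \<open>n = 1\<close> is the actual count.
\<close>

lemma full_eq_match_count: "full k \<Upsilon> n = match_count k \<Upsilon> n {1..<n}"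
proof (cases "n = 1")
  case True
  thus ?thesis by (simp add: full_def match_count_1)
next
  case False
  have "{1..n - 1} = {1..<n}"
    by auto
  hence "(\<forall>i\<in>{1..n - 1}. match_at k \<Upsilon> F i) \<longleftrightarrow> match_set n k \<Upsilon> F = {1..<n}" for F
    unfolding match_set_def by blast
  thus ?thesis using False by (simp add: full_def match_count_def)
qed

section \<open>The telescoping alternating sum\<close>

text \<open>
  The number of fillings with \<open>n\<close> columns whose matches are exactly the odd positions and the even
  positions up to \<open>2 * j\<close>. It interpolates between \<^const>\<open>Alt\<close> at \<open>j = 0\<close> and
  \<^const>\<open>full\<close> at \<open>2 * j + 2 \<ge> n\<close>.
\<close>

definition hybrid_count :: "nat \<Rightarrow> arr set \<Rightarrow> nat \<Rightarrow> nat \<Rightarrow> nat" where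
  "hybrid_count k \<Upsilon> n j = match_count k \<Upsilon> n {i \<in> {1..<n}. odd i \<or> i \<le> 2 * j}"

lemma full_Alt_mult:
  assumes "0 < j" "2 * j < n"
  shows "((k * n) choose (k * (2 * j))) * full k \<Upsilon> (2 * j) * Alt k \<Upsilon> (n - 2 * j) =
         hybrid_count k \<Upsilon> n (j - 1) + hybrid_count k \<Upsilon> n j"
proof -
  let ?K = "{1..<2 * j} \<union> (+) (2 * j) ` {i \<in> {1..<n - 2 * j}. odd i}"
  have shift: "(+) (2 * j) ` {i \<in> {1..<n - 2 * j}. odd i} = {i \<in> {2 * j<..<n}. odd i}"
  proof safe
    fix i assume "i \<in> {2 * j<..<n}" "odd i"
    thus "i \<in> (+) (2 * j) ` {i \<in> {1..<n - 2 * j}. odd i}"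
      by (intro image_eqI[of _ _ "i - 2 * j"]) auto
  qed auto
  have below: "i < 2 * j \<longleftrightarrow> odd i \<and> i \<le> 2 * j \<or> i \<le> 2 * (j - 1)" for i
    using assms(1) by presburger
  have K: "?K = {i \<in> {1..<n}. odd i \<or> i \<le> 2 * (j - 1)}"
    unfolding shift using assms by (auto simp: below)
  have "odd i \<or> i \<le> 2 * j \<longleftrightarrow> i = 2 * j \<or> odd i \<or> i \<le> 2 * (j - 1)" for i
    using assms(1) by presburger
  moreover have "2 * j \<in> {1..<n}"
    using assms by simp
  ultimately have K': "insert (2 * j) ?K = {i \<in> {1..<n}. odd i \<or> i \<le> 2 * j}"
    unfolding K by blast
  have "((k * (2 * j + (n - 2 * j))) choose (k * (2 * j))) *
          match_count k \<Upsilon> (2 * j) {1..<2 * j} *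
          match_count k \<Upsilon> (n - 2 * j) {i \<in> {1..<n - 2 * j}. odd i} =
        match_count k \<Upsilon> (2 * j + (n - 2 * j)) ?K +
        match_count k \<Upsilon> (2 * j + (n - 2 * j)) (insert (2 * j) ?K)"
    using assms by (intro match_count_mult) auto
  moreover have "2 * j + (n - 2 * j) = n" using assms by simp
  ultimately show ?thesis
    unfolding K' unfolding K by (simp only: full_eq_match_count Alt_eq_match_count hybrid_count_def)
qed

lemma alternating_sum_full_Alt:
  assumes "2 * m < n"
  shows "(\<Sum>j\<le>m. (-1) ^ j * int (((k * n) choose (k * (2 * j))) *
            full k \<Upsilon> (2 * j) * Alt k \<Upsilon> (n - 2 * j))) = (-1) ^ m * int (hybrid_count k \<Upsilon> n m)"
  using assms
proof (induction m)
  case 0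
  thus ?case
    by (simp add: full_eq_match_count match_count_0 Alt_eq_match_count hybrid_count_def cong: conj_cong)
next
  case (Suc m)
  have "((k * n) choose (k * (2 * Suc m))) * full k \<Upsilon> (2 * Suc m) * Alt k \<Upsilon> (n - 2 * Suc m) =
      hybrid_count k \<Upsilon> n m + hybrid_count k \<Upsilon> n (Suc m)"
    using full_Alt_mult[of "Suc m" n k \<Upsilon>] Suc.prems by simp
  thus ?case
    using Suc by (simp only: sum.atMost_Suc) (simp add: algebra_simps)
qed

lemma alternating_sum_full_Alt_complete:
  "(\<Sum>j\<le>n div 2. (-1) ^ j * int (((k * n) choose (k * (2 * j))) *
      full k \<Upsilon> (2 * j) * Alt k \<Upsilon> (n - 2 * j))) =
   (if n = 0 then 1 else if even n then 0 else (-1) ^ (n div 2) * int (full k \<Upsilon> n))"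
proof -
  consider "n = 0" | m where "n = Suc (2 * m)" | m where "n = 2 * Suc m"
    by (metis oddE evenE Suc_eq_plus1 mult_0_right old.nat.exhaust)
  thus ?thesis
  proof cases
    case 1
    thus ?thesis by (simp add: full_eq_match_count match_count_0 Alt_eq_match_count)
  next
    case (2 m)
    have "{i \<in> {1..<n}. odd i \<or> i \<le> 2 * m} = {1..<n}"
      using 2 by auto
    hence "hybrid_count k \<Upsilon> n m = full k \<Upsilon> n"
      by (simp add: hybrid_count_def full_eq_match_count)
    thus ?thesis
      using 2 alternating_sum_full_Alt[of m n k \<Upsilon>] by simp
  next
    case (3 m)
    \<comment> \<open>The last term is \<open>full n\<close> itself, since its alternating part is empty. It cancels the
      sum of the preceding terms.\<close>
    have "odd i \<or> i \<le> 2 * m" if "i < n" for i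
      using that 3 by presburger
    hence "{i \<in> {1..<n}. odd i \<or> i \<le> 2 * m} = {1..<n}"
      by auto
    hence "hybrid_count k \<Upsilon> n m = full k \<Upsilon> n"
      by (simp add: hybrid_count_def full_eq_match_count)
    moreover have "n div 2 = Suc m" "2 * m < n" using 3 by auto
    ultimately show ?thesis
      using 3 alternating_sum_full_Alt[of m n k \<Upsilon>]
      by (simp add: Alt_eq_match_count match_count_0)
  qed
qed

section \<open>The generating functions\<close>

lemma sum_even_index:
  fixes f :: "nat \<Rightarrow> 'a::comm_monoid_add"
  assumes "\<And>i. odd i \<Longrightarrow> f i = 0"
  shows "(\<Sum>i=0..n. f i) = (\<Sum>j\<le>n div 2. f (2 * j))"
proof -
  have "(\<Sum>j\<le>n div 2. f (2 * j)) = (\<Sum>i\<in>(*) 2 ` {..n div 2}. f i)"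
    by (subst sum.reindex) (auto simp: inj_on_def)
  also have "\<dots> = (\<Sum>i=0..n. f i)"
  proof (intro sum.mono_neutral_left ballI)
    fix i assume i: "i \<in> {0..n} - (*) 2 ` {..n div 2}"
    have "odd i"
    proof
      assume "even i"
      hence "i = 2 * (i div 2)" "i div 2 \<le> n div 2"
        using i by (auto intro: div_le_mono)
      thus False using i by blast
    qed
    thus "f i = 0" by (rule assms)
  qed auto
  finally show ?thesis by simp
qed

text \<open>
  Since \<open>E\<close> is an even series, the coefficient of \<open>E * A\<close> at \<open>n\<close> involves only the coefficients of
  \<open>A\<close> at indices of the parity of \<open>n\<close>. The hypothesis on \<open>A\<close> is restricted to these, so that the
  lemma applies to the even series and to the odd series of \<^const>\<open>Alt\<close>.
\<close>

lemma fps_full_mult_Alt_nth: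
  fixes E A :: "rat fps"
  assumes E: "\<And>m. fps_nth E m = (if even m then (-1) ^ (m div 2) * of_nat (full k \<Upsilon> m) / fact (k * m) else 0)"
    and A: "\<And>m. even m = even n \<Longrightarrow> fps_nth A m = of_nat (Alt k \<Upsilon> m) / fact (k * m)"
  shows "fps_nth (E * A) n = (if n = 0 then 1 else if even n then 0
           else (-1) ^ (n div 2) * of_nat (full k \<Upsilon> n) / fact (k * n))"
proof -
  have "fps_nth (E * A) n = (\<Sum>j\<le>n div 2. fps_nth E (2 * j) * fps_nth A (n - 2 * j))"
    unfolding fps_mult_nth by (rule sum_even_index) (simp add: E)
  also have "\<dots> = (\<Sum>j\<le>n div 2. of_int ((-1) ^ j * int (((k * n) choose (k * (2 * j))) *
      full k \<Upsilon> (2 * j) * Alt k \<Upsilon> (n - 2 * j))) / fact (k * n))"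
  proof (rule sum.cong)
    fix j assume "j \<in> {..n div 2}"
    hence j: "2 * j \<le> n" by auto
    have "of_nat ((k * n) choose (k * (2 * j))) =
        (fact (k * n) / (fact (k * (2 * j)) * fact (k * (n - 2 * j))) :: rat)"
      using j by (subst binomial_fact) (auto simp: right_diff_distrib')
    thus "fps_nth E (2 * j) * fps_nth A (n - 2 * j) = of_int ((-1) ^ j * int (((k * n) choose (k * (2 * j))) *
      full k \<Upsilon> (2 * j) * Alt k \<Upsilon> (n - 2 * j))) / fact (k * n)"
      using j by (simp add: E A)
  qed simp
  also have "\<dots> = of_int (\<Sum>j\<le>n div 2. (-1) ^ j * int (((k * n) choose (k * (2 * j))) *
      full k \<Upsilon> (2 * j) * Alt k \<Upsilon> (n - 2 * j))) / fact (k * n)"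
    by (simp only: of_int_sum sum_divide_distrib)
  finally show ?thesis
    unfolding alternating_sum_full_Alt_complete by simp
qed

theorem corollary9:
  fixes k :: nat and \<Upsilon> :: "arr set"
  assumes "k \<ge> 1"
    and "\<Upsilon> \<subseteq> fillings 2 k"
  shows "1 + even_series (\<lambda>n. of_nat (Alt k \<Upsilon> (2 * n)) / fact (2 * k * n)) =
           1 / (1 + even_series (\<lambda>n. (-1) ^ n / fact (2 * k * n) * of_nat (full k \<Upsilon> (2 * n))))
         \<and>
         odd_series (\<lambda>n. of_nat (Alt k \<Upsilon> (2 * n - 1)) / fact (k * (2 * n - 1))) =
           odd_series (\<lambda>n. (-1) ^ (n - 1) / fact (k * (2 * n - 1)) * of_nat (full k \<Upsilon> (2 * n - 1)))
           / (1 + even_series (\<lambda>n. (-1) ^ n / fact (2 * k * n) * of_nat (full k \<Upsilon> (2 * n))))"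
proof -
  define E where "E = 1 + even_series (\<lambda>n. (-1) ^ n / fact (2 * k * n) * of_nat (full k \<Upsilon> (2 * n)))"
  define A where "A = 1 + even_series (\<lambda>n. of_nat (Alt k \<Upsilon> (2 * n)) / fact (2 * k * n))"
  define B where "B = odd_series (\<lambda>n. of_nat (Alt k \<Upsilon> (2 * n - 1)) / fact (k * (2 * n - 1)))"
  define C where "C = odd_series (\<lambda>n. (-1) ^ (n - 1) / fact (k * (2 * n - 1)) * of_nat (full k \<Upsilon> (2 * n - 1)))"
  have E: "fps_nth E m = (if even m then (-1) ^ (m div 2) * of_nat (full k \<Upsilon> m) / fact (k * m) else 0)" for m
    by (auto simp: E_def even_series_def full_eq_match_count match_count_0 mult_ac elim!: evenE)
  have A: "fps_nth A m = (if even m then of_nat (Alt k \<Upsilon> m) / fact (k * m) else 0)" for m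
    by (auto simp: A_def even_series_def Alt_eq_match_count match_count_0 mult_ac elim!: evenE)
  have B: "fps_nth B m = (if odd m then of_nat (Alt k \<Upsilon> m) / fact (k * m) else 0)" for m
    by (auto simp: B_def odd_series_def elim!: oddE)
  have C: "fps_nth C m = (if odd m then (-1) ^ (m div 2) * of_nat (full k \<Upsilon> m) / fact (k * m) else 0)" for m
    by (auto simp: C_def odd_series_def elim!: oddE)
  have "E * A = 1"
  proof (rule fps_ext)
    fix n
    show "fps_nth (E * A) n = fps_nth 1 n"
    proof (cases "even n")
      case True
      thus ?thesis using fps_full_mult_Alt_nth[OF E, where A = A and n = n] by (simp add: A)
    next
      case False
      hence "fps_nth E i * fps_nth A (n - i) = 0" if "i \<le> n" for i
        using that by (auto simp: E A)
      thus ?thesis using False by (auto simp: fps_mult_nth intro!: sum.neutral)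
    qed
  qed
  moreover have "E * B = C"
  proof (rule fps_ext)
    fix n
    show "fps_nth (E * B) n = fps_nth C n"
    proof (cases "odd n")
      case True
      hence "n \<noteq> 0" by (intro notI) simp
      thus ?thesis using True fps_full_mult_Alt_nth[OF E, where A = B and n = n] by (simp add: B C)
    next
      case False
      hence "fps_nth E i * fps_nth B (n - i) = 0" if "i \<le> n" for i
        using that by (auto simp: E B)
      thus ?thesis using False by (auto simp: fps_mult_nth C intro!: sum.neutral)
    qed
  qed
  moreover have "E \<noteq> 0"
    using \<open>E * A = 1\<close> by auto
  ultimately have "A = 1 / E \<and> B = C / E"
    by (metis nonzero_mult_div_cancel_left)
  thus ?thesis
    unfolding A_def B_def C_def E_def .
qed

end
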